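(* There are no non-zero weakly compact derivations on $L^1_{\text{loc}}$.
   Context: $L^1_{\text{loc}}$ is the complex Fréchet algebra of (equivalence classes of) locally integrable functions on $\mathbb R^+=[0,\infty)$, with seminorms $f\mapsto\int_0^n|f(t)|\,dt$ $(n\in\mathbb N)$ and convolution product $(f*g)(t)=\int_0^tf(s)g(t-s)\,ds$. A derivation on $L^1_{\text{loc}}$ is a linear map $D:L^1_{\text{loc}}\to L^1_{\text{loc}}$ with $D(f*g)=D(f)*g+f*D(g)$ for all $f,g$. It is known that every derivation on $L^1_{\text{loc}}$ is continuous and has the form $D_\mu f=Xf*\mu$ for some locally finite complex Borel measure $\mu$ on $\mathbb R^+$, where $(Xf)(t)=tf(t)$. A linear operator between Fréchet spaces is weakly compact if it maps some neighbourhood of $0$ to a weakly relatively compact set. *)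

theory Defs
  imports "HOL-Analysis.Analysis"
begin

section \<open>Convolution of locally integrable functions on the half-line\<close>

text \<open>
  A function on \<open>[0,\<infinity>)\<close> is represented by a function on all of \<^typ>\<open>real\<close> whose
  values at negative arguments are never looked at.
\<close>

definition locally_integrable :: "(real \<Rightarrow> complex) \<Rightarrow> bool" where
  "locally_integrable f \<longleftrightarrow> (\<forall>b. set_integrable lebesgue {0..b} f)"

definition eq_ae :: "(real \<Rightarrow> complex) \<Rightarrow> (real \<Rightarrow> complex) \<Rightarrow> bool" where
  "eq_ae f g \<longleftrightarrow> (AE t in lebesgue. 0 \<le> t \<longrightarrow> f t = g t)"

definition convolution :: "(real \<Rightarrow> complex) \<Rightarrow> (real \<Rightarrow> complex) \<Rightarrow> real \<Rightarrow> complex" where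
  "convolution f g t = (LINT s:{0..t}|lebesgue. f s * g (t - s))"

lemma AE_lborel_reflect:
  fixes P :: "real \<Rightarrow> bool"
  assumes "AE x in lborel. P x"
  shows "AE x in lborel. P (t - x)"
proof -
  obtain N where N: "{x \<in> space lborel. \<not> P x} \<subseteq> N" "emeasure lborel N = 0" "N \<in> sets lborel"
    using assms by (rule AE_E)
  have "AE x in lborel. x \<notin> N"
    using N by (intro AE_not_in) auto
  moreover have "Measurable.pred borel (\<lambda>x. x \<notin> N)"
    using N by simp
  ultimately have "AE x in lborel. t + (-1) * x \<notin> N"
    by (intro AE_borel_affine) auto
  then show ?thesis
    by eventually_elim (use N in auto)
qed

lemma AE_lebesgue_reflect:
  fixes P :: "real \<Rightarrow> bool"
  assumes "AE x in lebesgue. P x"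
  shows "AE x in lebesgue. P (t - x)"
  using AE_lborel_reflect assms unfolding AE_completion_iff .

lemma integrable_lebesgue_borel_rep:
  fixes f :: "real \<Rightarrow> complex"
  assumes "integrable lebesgue f"
  obtains f' where "integrable lborel f'" "AE x in lebesgue. f x = f' x"
proof -
  have "(\<lambda>x. Re (f x)) \<in> borel_measurable lebesgue" "(\<lambda>x. Im (f x)) \<in> borel_measurable lebesgue"
    using borel_measurable_integrable[OF assms] by auto
  then obtain u v where u: "u \<in> borel_measurable lborel" "AE x in lborel. Re (f x) = u x"
    and v: "v \<in> borel_measurable lborel" "AE x in lborel. Im (f x) = v x"
    by (metis completion_ex_borel_measurable_real)
  let ?f' = "\<lambda>x. complex_of_real (u x) + \<i> * complex_of_real (v x)"
  have m: "?f' \<in> borel_measurable lborel"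
    using u(1) v(1) by measurable
  have ae: "AE x in lebesgue. f x = ?f' x"
    unfolding AE_completion_iff using u(2) v(2)
    by eventually_elim (simp add: complex_eq_iff)
  have "integrable lebesgue ?f'"
    using assms measurable_completion[OF m] ae by (rule integrable_cong_AE_imp)
  then have "integrable lborel ?f'"
    using m by (simp add: integrable_completion)
  then show ?thesis using ae that by blast
qed

lemma integrable_convolution_lborel:
  fixes F G :: "real \<Rightarrow> complex"
  assumes F: "integrable lborel F" and G: "integrable lborel G"
  shows "integrable lborel (\<lambda>t. LINT s|lborel. F s * G (t - s))"
proof -
  have [measurable]: "F \<in> borel_measurable borel" "G \<in> borel_measurable borel"
    using F G by (auto dest: borel_measurable_integrable)
  have shift: "integrable lborel (\<lambda>t. G (t - s))" for s
    using lborel_integrable_real_affine[OF G, of 1 "-s"] by simp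
  have nrm: "(LINT t|lborel. norm (G (t - s))) = (LINT t|lborel. norm (G t))" for s
    using lborel_integral_real_affine[of 1 "\<lambda>t. norm (G t)" "-s"] by simp
  have "integrable (lborel \<Otimes>\<^sub>M lborel) (\<lambda>(s, t). F s * G (t - s))"
  proof (rule lborel_pair.Fubini_integrable)
    show "integrable lborel (\<lambda>s. LINT t|lborel. norm (case (s, t) of (s, t) \<Rightarrow> F s * G (t - s)))"
      using F by (simp add: norm_mult nrm)
  qed (use shift in auto)
  then show ?thesis
    by (rule lborel_pair.integrable_snd)
qed

lemma integrable_convolution_lebesgue:
  fixes F G :: "real \<Rightarrow> complex"
  assumes F: "integrable lebesgue F" and G: "integrable lebesgue G"
  shows "integrable lebesgue (\<lambda>t. LINT s|lebesgue. F s * G (t - s))"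
proof -
  obtain F' where F': "integrable lborel F'" "AE x in lebesgue. F x = F' x"
    using integrable_lebesgue_borel_rep[OF F] .
  obtain G' where G': "integrable lborel G'" "AE x in lebesgue. G x = G' x"
    using integrable_lebesgue_borel_rep[OF G] .
  have [measurable]: "F' \<in> borel_measurable borel" "G' \<in> borel_measurable borel"
    using F' G' by (auto dest: borel_measurable_integrable)
  have eq: "(LINT s|lebesgue. F s * G (t - s)) = (LINT s|lborel. F' s * G' (t - s))" for t
  proof -
    have m: "(\<lambda>s. F' s * G' (t - s)) \<in> borel_measurable lborel"
      by measurable
    have ae: "AE s in lebesgue. F' s * G' (t - s) = F s * G (t - s)"
      using F'(2) AE_lebesgue_reflect[OF G'(2), of t] by eventually_elim simp
    have "(LINT s|lebesgue. F s * G (t - s)) = (LINT s|lebesgue. F' s * G' (t - s))"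
      using ae measurable_completion[OF m] borel_measurable_AE[OF measurable_completion[OF m] ae]
      by (intro integral_cong_AE) auto
    also have "\<dots> = (LINT s|lborel. F' s * G' (t - s))"
      using m by (rule integral_completion)
    finally show ?thesis .
  qed
  show ?thesis
    unfolding eq using integrable_convolution_lborel[OF F'(1) G'(1)]
    by (simp add: integrable_completion borel_measurable_integrable)
qed

lemma convolution_eq_truncated:
  assumes "t \<le> b"
  shows "convolution f g t
    = (LINT s|lebesgue. (indicator {0..b} s *\<^sub>R f s) * (indicator {0..b} (t - s) *\<^sub>R g (t - s)))"
  unfolding convolution_def set_lebesgue_integral_def
  using assms by (intro Bochner_Integration.integral_cong) (auto simp: indicator_def)

lemma locally_integrable_convolution:
  assumes "locally_integrable f" "locally_integrable g"
  shows "locally_integrable (convolution f g)"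
  unfolding locally_integrable_def
proof
  fix b :: real
  let ?H = "\<lambda>t. LINT s|lebesgue. (indicator {0..b} s *\<^sub>R f s) * (indicator {0..b} (t - s) *\<^sub>R g (t - s))"
  have "integrable lebesgue ?H"
    using assms unfolding locally_integrable_def set_integrable_def
    by (intro integrable_convolution_lebesgue) auto
  then have "set_integrable lebesgue {0..b} ?H"
    unfolding set_integrable_def
    by (rule integrable_mult_indicator[rotated]) simp
  then show "set_integrable lebesgue {0..b} (convolution f g)"
    unfolding set_integrable_def
    by (rule back_subst[of "integrable lebesgue"])
       (auto simp: indicator_def convolution_eq_truncated fun_eq_iff)
qed

lemma convolution_cong:
  assumes f: "locally_integrable f" and g: "locally_integrable g"
    and ff': "eq_ae f f'" and gg': "eq_ae g g'"
  shows "convolution f g t = convolution f' g' t"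
proof -
  let ?h = "\<lambda>f g s. (indicator {0..t} s *\<^sub>R f s) * (indicator {0..t} (t - s) *\<^sub>R g (t - s)) :: complex"
  have "(\<lambda>s. indicator {0..t} (t + (-1) * s) *\<^sub>R g (t + (-1) * s)) \<in> borel_measurable lebesgue"
    using g unfolding locally_integrable_def set_integrable_def
    by (intro borel_measurable_integrable lebesgue_integrable_real_affine) auto
  moreover have "(\<lambda>s. indicator {0..t} s *\<^sub>R f s) \<in> borel_measurable lebesgue"
    using f unfolding locally_integrable_def set_integrable_def
    by (intro borel_measurable_integrable) auto
  ultimately have m: "?h f g \<in> borel_measurable lebesgue"
    by (intro borel_measurable_times) auto
  have ae: "AE s in lebesgue. ?h f g s = ?h f' g' s"
    using ff'[unfolded eq_ae_def] AE_lebesgue_reflect[OF gg'[unfolded eq_ae_def], of t]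
    by eventually_elim (auto simp: indicator_def)
  show ?thesis
    unfolding convolution_eq_truncated[OF order_refl]
    using ae m borel_measurable_AE[OF m ae] by (intro integral_cong_AE) auto
qed


section \<open>The algebra of locally integrable functions modulo null sets\<close>

quotient_type l1loc = "real \<Rightarrow> complex" / partial:
  "\<lambda>f g. locally_integrable f \<and> locally_integrable g \<and> eq_ae f g"
proof (rule part_equivpI)
  have "locally_integrable (\<lambda>_. 0)"
    by (simp add: locally_integrable_def set_integrable_def)
  then show "\<exists>f. locally_integrable f \<and> locally_integrable f \<and> eq_ae f f"
    by (auto simp: eq_ae_def)
  show "symp (\<lambda>f g. locally_integrable f \<and> locally_integrable g \<and> eq_ae f g)"
    by (auto simp: symp_def eq_ae_def)
  show "transp (\<lambda>f g. locally_integrable f \<and> locally_integrable g \<and> eq_ae f g)"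
    unfolding transp_def eq_ae_def
    by (auto elim: eventually_elim2)
qed

instantiation l1loc :: ab_group_add
begin

lift_definition zero_l1loc :: l1loc is "\<lambda>_. 0"
  by (simp add: locally_integrable_def eq_ae_def set_integrable_def)

lift_definition plus_l1loc :: "l1loc \<Rightarrow> l1loc \<Rightarrow> l1loc" is "\<lambda>f g t. f t + g t"
  by (auto simp: locally_integrable_def eq_ae_def elim: eventually_elim2)

lift_definition uminus_l1loc :: "l1loc \<Rightarrow> l1loc" is "\<lambda>f t. - f t"
  by (auto simp: locally_integrable_def eq_ae_def set_integrable_def)

lift_definition minus_l1loc :: "l1loc \<Rightarrow> l1loc \<Rightarrow> l1loc" is "\<lambda>f g t. f t - g t"
  by (auto simp: locally_integrable_def eq_ae_def elim: eventually_elim2)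

instance
  by standard
     (transfer; auto simp: locally_integrable_def eq_ae_def set_integrable_def algebra_simps)+

end

lift_definition scale_l1loc :: "complex \<Rightarrow> l1loc \<Rightarrow> l1loc" is "\<lambda>c f t. c * f t"
  by (auto simp: locally_integrable_def eq_ae_def)

interpretation l1loc: vector_space scale_l1loc
  by standard
     (transfer; auto simp: locally_integrable_def eq_ae_def algebra_simps)+

instantiation l1loc :: times
begin

lift_definition times_l1loc :: "l1loc \<Rightarrow> l1loc \<Rightarrow> l1loc" is convolution
  using convolution_cong
  by (auto simp: locally_integrable_convolution eq_ae_def)

instance ..

end

lift_definition seminorm_l1loc :: "nat \<Rightarrow> l1loc \<Rightarrow> real"
  is "\<lambda>n f. LINT t:{0..real n}|lebesgue. norm (f t)"
proof -
  fix n and f g :: "real \<Rightarrow> complex"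
  assume *: "locally_integrable f \<and> locally_integrable g \<and> eq_ae f g"
  have "set_integrable lebesgue {0..real n} (\<lambda>t. norm (h t))" if "locally_integrable h" for h
    using that unfolding locally_integrable_def by (intro set_integrable_norm) auto
  with * have m: "(\<lambda>t. indicator {0..real n} t *\<^sub>R norm (f t)) \<in> borel_measurable lebesgue"
    "(\<lambda>t. indicator {0..real n} t *\<^sub>R norm (g t)) \<in> borel_measurable lebesgue"
    unfolding set_integrable_def by (auto intro!: borel_measurable_integrable)
  have "AE t in lebesgue. indicator {0..real n} t *\<^sub>R norm (f t) = indicator {0..real n} t *\<^sub>R norm (g t)"
    using * unfolding eq_ae_def by (auto simp: indicator_def)
  with m show "(LINT t:{0..real n}|lebesgue. norm (f t)) = (LINT t:{0..real n}|lebesgue. norm (g t))"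
    unfolding set_lebesgue_integral_def by (intro integral_cong_AE) auto
qed

lemma seminorm_l1loc_mono: "m \<le> n \<Longrightarrow> seminorm_l1loc m f \<le> seminorm_l1loc n f"
proof (transfer, goal_cases)
  case (1 m n f)
  then have int: "set_integrable lebesgue {0..real k} (\<lambda>t. norm (f t))" for k
    unfolding locally_integrable_def by (intro set_integrable_norm) auto
  show ?case
    unfolding set_lebesgue_integral_def
    using int \<open>m \<le> n\<close> unfolding set_integrable_def
    by (intro integral_mono) (auto simp: indicator_def)
qed

text \<open>
  Since the seminorms increase with \<open>n\<close>, the balls of the single seminorms form a
  neighbourhood base of the topology that the seminorms generate.
\<close>

instantiation l1loc :: topological_space
begin

definition open_l1loc :: "l1loc set \<Rightarrow> bool" where
  "open_l1loc U \<longleftrightarrow> (\<forall>f\<in>U. \<exists>n. \<exists>e>0. \<forall>g. seminorm_l1loc n (g - f) < e \<longrightarrow> g \<in> U)"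

instance
proof
  show "open (UNIV :: l1loc set)"
    by (auto simp: open_l1loc_def intro: exI[of _ "1::real"])
next
  fix S T :: "l1loc set"
  assume S: "open S" and T: "open T"
  show "open (S \<inter> T)"
    unfolding open_l1loc_def
  proof
    fix f assume "f \<in> S \<inter> T"
    with S T obtain m d n e
      where 1: "d > 0" "\<And>g. seminorm_l1loc m (g - f) < d \<Longrightarrow> g \<in> S"
        and 2: "e > 0" "\<And>g. seminorm_l1loc n (g - f) < e \<Longrightarrow> g \<in> T"
      unfolding open_l1loc_def by (metis IntE)
    have "g \<in> S \<inter> T" if "seminorm_l1loc (max m n) (g - f) < min d e" for g
      using that 1(2)[of g] 2(2)[of g]
        seminorm_l1loc_mono[of m "max m n" "g - f"] seminorm_l1loc_mono[of n "max m n" "g - f"]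
      by auto
    moreover have "min d e > 0"
      using 1 2 by simp
    ultimately show "\<exists>n. \<exists>e>0. \<forall>g. seminorm_l1loc n (g - f) < e \<longrightarrow> g \<in> S \<inter> T"
      by blast
  qed
next
  fix K :: "l1loc set set"
  assume "\<forall>S\<in>K. open S"
  then show "open (\<Union>K)"
    unfolding open_l1loc_def by (meson UnionE UnionI)
qed

end


section \<open>Weakly compact operators and derivations\<close>

text \<open>
  The distribution has no type class of complex topological vector spaces, so the scalar
  multiplications are explicit parameters.
\<close>

definition weak_topology ::
    "(complex \<Rightarrow> 'a \<Rightarrow> 'a) \<Rightarrow> 'a::{ab_group_add, topological_space} topology" where
  "weak_topology smul = topology_generated_by
     {\<phi> -` V | \<phi> V. Vector_Spaces.linear smul (*) \<phi> \<and> continuous_on UNIV \<phi> \<and> open (V :: complex set)}"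

definition weakly_relatively_compact ::
    "(complex \<Rightarrow> 'a \<Rightarrow> 'a) \<Rightarrow> 'a::{ab_group_add, topological_space} set \<Rightarrow> bool" where
  "weakly_relatively_compact smul S \<longleftrightarrow>
     compactin (weak_topology smul) (weak_topology smul closure_of S)"

definition weakly_compact_operator ::
    "(complex \<Rightarrow> 'a \<Rightarrow> 'a) \<Rightarrow> (complex \<Rightarrow> 'b \<Rightarrow> 'b) \<Rightarrow>
     ('a::{ab_group_add, topological_space} \<Rightarrow> 'b::{ab_group_add, topological_space}) \<Rightarrow> bool" where
  "weakly_compact_operator smul1 smul2 T \<longleftrightarrow>
     Vector_Spaces.linear smul1 smul2 T \<and>
     (\<exists>N. 0 \<in> interior N \<and> weakly_relatively_compact smul2 (T ` N))"

definition l1loc_derivation :: "(l1loc \<Rightarrow> l1loc) \<Rightarrow> bool" where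
  "l1loc_derivation D \<longleftrightarrow>
     Vector_Spaces.linear scale_l1loc scale_l1loc D \<and> (\<forall>f g. D (f * g) = D f * g + f * D g)"

end

(*
  Weak compactness is only used through boundedness: if D maps the ball {g. p_n g < e} of the n-th
  seminorm p_n to a weakly relatively compact set, then every continuous functional is bounded on
  D f for all f in that ball. If p_n f = 0, the whole line through f lies in the ball, so every
  continuous functional vanishes at D f; the functionals f |-> \<integral>_0^b f separate points, hence
  D f = 0. So D kills the ideal of functions supported in [n, \<infinity>). For u = indicator of [n, \<infinity>)
  and arbitrary g, both u and u * g lie in that ideal, so 0 = D (u * g) = D u * g + u * D g = u * D g.
  Since (u * h) t = \<integral>_0^(t - n) h, this forces D g = 0.
*)
theory Submission
  imports Defs
begin

section \<open>Functions with vanishing integrals over initial intervals\<close>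

text \<open>Dynkin's argument: the sets over which \<open>f\<close> integrates to 0 are closed under
  complements and countable disjoint unions and contain the intersection-stable half-lines, hence
  all Borel sets.\<close>

lemma AE_zero_if_integral_atMost_zero:
  fixes f :: "real \<Rightarrow> 'b::{banach, second_countable_topology}"
  assumes f: "integrable lborel f" and zero: "\<And>b. (LINT x:{..b}|lborel. f x) = 0"
  shows "AE x in lborel. f x = 0"
proof (rule sigma_finite_measure.density_zero[OF sigma_finite_lborel f])
  have int: "set_integrable lborel A f" if "A \<in> sets borel" for A
    using f that unfolding set_integrable_def by (intro integrable_mult_indicator) auto
  \<comment> \<open>The complement case needs the integral over the whole line, obtained here as the
    limit over growing half-lines.\<close>
  have "((\<lambda>b. LINT x:{..b}|lborel. f x) \<longlongrightarrow> (LINT x|lborel. f x)) at_top"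
    unfolding set_lebesgue_integral_def by (rule tendsto_integral_at_top) (use f in auto)
  then have total: "(LINT x|lborel. f x) = 0"
    by (simp add: zero tendsto_const_iff)
  fix A :: "real set"
  assume "A \<in> sets lborel"
  then have A: "A \<in> sigma_sets UNIV (range atMost)"
    by (simp add: borel_eq_atMost)
  have stable: "Int_stable (range atMost :: real set set)"
    by (auto simp: Int_stable_def)
  have "range atMost \<subseteq> Pow (UNIV :: real set)"
    by simp
  from stable this A show "(LINT x:A|lborel. f x) = 0"
  proof (induction rule: sigma_sets_induct_disjoint)
    case (basic A)
    then show ?case using zero by auto
  next
    case empty
    show ?case by (simp add: set_lebesgue_integral_def)
  next
    case (compl A)
    then have A: "A \<in> sets borel"
      by (simp add: borel_eq_atMost)
    have "(LINT x:A \<union> (UNIV - A)|lborel. f x) = (LINT x:A|lborel. f x) + (LINT x:UNIV - A|lborel. f x)"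
      using A by (intro set_integral_Un int) auto
    then show ?case
      using compl total by (simp add: set_lebesgue_integral_def)
  next
    case (union A)
    then have A: "A i \<in> sets borel" for i
      by (auto simp: borel_eq_atMost)
    have "(LINT x:(\<Union>i. A i)|lborel. f x) = (\<Sum>i. LINT x:A i|lborel. f x)"
      using A union by (intro lebesgue_integral_countable_add int) (auto simp: disjoint_family_on_def)
    then show ?case using union by simp
  qed
qed

text \<open>Cut off at \<open>n\<close> and extended by 0, \<open>f\<close> becomes integrable on
  the line, and its integrals over half-lines reduce to those over \<open>{0..min b n}\<close>. A
  Borel representative carries this from \<open>lebesgue\<close> to \<open>lborel\<close>, where the
  preceding lemma applies.\<close>

lemma eq_ae_zero_if_integral_zero:
  assumes f: "locally_integrable f" and zero: "\<And>b. 0 < b \<Longrightarrow> (LINT t:{0..b}|lebesgue. f t) = 0"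
  shows "eq_ae f (\<lambda>_. 0)"
proof -
  have ae: "AE t in lebesgue. t \<in> {0..real n} \<longrightarrow> f t = 0" for n
  proof -
    let ?f = "\<lambda>t. indicator {0..real n} t *\<^sub>R f t"
    have int: "integrable lebesgue ?f"
      using f by (simp add: locally_integrable_def set_integrable_def)
    obtain f' where f': "integrable lborel f'" "AE t in lebesgue. ?f t = f' t"
      using integrable_lebesgue_borel_rep[OF int] .
    have "(LINT t:{..b}|lborel. f' t) = 0" for b
    proof -
      have m: "(\<lambda>t. indicator {..b} t *\<^sub>R f' t) \<in> borel_measurable lborel"
        using f'(1) by (auto intro!: borel_measurable_scaleR dest: borel_measurable_integrable)
      have "(LINT t:{..b}|lborel. f' t) = (LINT t|lebesgue. indicator {..b} t *\<^sub>R f' t)"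
        unfolding set_lebesgue_integral_def using m by (rule integral_completion[symmetric])
      also have "\<dots> = (LINT t|lebesgue. indicator {..b} t *\<^sub>R ?f t)"
      proof (rule integral_cong_AE)
        show "(\<lambda>t. indicator {..b} t *\<^sub>R f' t) \<in> borel_measurable lebesgue"
          using m by (rule measurable_completion)
        show "(\<lambda>t. indicator {..b} t *\<^sub>R ?f t) \<in> borel_measurable lebesgue"
          by (intro borel_measurable_scaleR[OF _ borel_measurable_integrable[OF int]] borel_measurable_indicator) auto
        show "AE t in lebesgue. indicator {..b} t *\<^sub>R f' t = indicator {..b} t *\<^sub>R ?f t"
          using f'(2) by eventually_elim simp
      qed
      also have "\<dots> = (LINT t:{0..min b n}|lebesgue. f t)"
        unfolding set_lebesgue_integral_def
        by (intro Bochner_Integration.integral_cong) (auto simp: indicator_def)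
      also have "\<dots> = 0"
      \<comment> \<open>The hypothesis speaks of positive endpoints only; otherwise the interval
        lies in the null set \<open>{0}\<close>.\<close>
      proof (cases "0 < min b (real n)")
        case False
        have "AE t in lebesgue. t \<noteq> (0::real)"
          by (simp add: AE_completion_iff AE_lborel_singleton)
        then have "AE t in lebesgue. indicator {0..min b (real n)} t *\<^sub>R f t = 0"
          by eventually_elim (use False in \<open>auto simp: indicator_def\<close>)
        then show ?thesis
          unfolding set_lebesgue_integral_def by (rule integral_eq_zero_AE)
      qed (rule zero)
      finally show ?thesis .
    qed
    with f'(1) have "AE t in lborel. f' t = 0"
      by (rule AE_zero_if_integral_atMost_zero)
    then have "AE t in lebesgue. f' t = 0"
      by (simp add: AE_completion_iff)
    with f'(2) show ?thesis
      by eventually_elim (auto simp: indicator_def)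
  qed
  \<comment> \<open>The countably many exceptional null sets are merged; every
    \<open>t \<ge> 0\<close> lies in some \<open>{0..real n}\<close>.\<close>
  have "AE t in lebesgue. \<forall>n. t \<in> {0..real n} \<longrightarrow> f t = 0"
    unfolding AE_all_countable using ae by blast
  then show ?thesis
    unfolding eq_ae_def by eventually_elim (use real_arch_simple in auto)
qed

section \<open>A separating family of continuous linear functionals\<close>

lift_definition integral_l1loc :: "real \<Rightarrow> l1loc \<Rightarrow> complex"
  is "\<lambda>b f. LINT t:{0..b}|lebesgue. f t"
proof -
  fix b and f g :: "real \<Rightarrow> complex"
  assume *: "locally_integrable f \<and> locally_integrable g \<and> eq_ae f g"
  then have m: "(\<lambda>t. indicator {0..b} t *\<^sub>R f t) \<in> borel_measurable lebesgue"
    "(\<lambda>t. indicator {0..b} t *\<^sub>R g t) \<in> borel_measurable lebesgue"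
    unfolding locally_integrable_def set_integrable_def by (auto intro!: borel_measurable_integrable)
  have "AE t in lebesgue. indicator {0..b} t *\<^sub>R f t = indicator {0..b} t *\<^sub>R g t"
    using * unfolding eq_ae_def by (auto simp: indicator_def)
  with m show "(LINT t:{0..b}|lebesgue. f t) = (LINT t:{0..b}|lebesgue. g t)"
    unfolding set_lebesgue_integral_def by (intro integral_cong_AE) auto
qed

lemma linear_integral_l1loc: "Vector_Spaces.linear scale_l1loc (*) (integral_l1loc b)"
proof -
  have "integral_l1loc b (f + g) = integral_l1loc b f + integral_l1loc b g" for f g
    by transfer (simp add: locally_integrable_def)
  moreover have "integral_l1loc b (scale_l1loc c f) = c * integral_l1loc b f" for c f
    by transfer simp
  ultimately show ?thesis
    unfolding Vector_Spaces.linear_iff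
    by (simp add: l1loc.vector_space_axioms vector_space_over_itself.vector_space_axioms)
qed

lemma norm_integral_l1loc_le: "b \<le> real n \<Longrightarrow> norm (integral_l1loc b f) \<le> seminorm_l1loc n f"
proof (transfer, goal_cases)
  case (1 b n f)
  then have int: "set_integrable lebesgue {0..a} f" for a
    by (simp add: locally_integrable_def)
  have "norm (LINT t:{0..b}|lebesgue. f t) \<le> (LINT t:{0..b}|lebesgue. norm (f t))"
    using int by (rule set_integral_norm_bound)
  also have "\<dots> \<le> (LINT t:{0..real n}|lebesgue. norm (f t))"
    unfolding set_lebesgue_integral_def
    using set_integrable_norm[OF int] \<open>b \<le> real n\<close> unfolding set_integrable_def
    by (intro integral_mono) (auto simp: indicator_def)
  finally show ?case .
qed

lemma continuous_integral_l1loc: "continuous_on UNIV (integral_l1loc b)"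
  unfolding continuous_on_open_vimage[OF open_UNIV]
proof (intro allI impI)
  fix V :: "complex set"
  assume "open V"
  have "\<exists>n. \<exists>e>0. \<forall>g. seminorm_l1loc n (g - f) < e \<longrightarrow> integral_l1loc b g \<in> V"
    if f: "integral_l1loc b f \<in> V" for f
  proof -
    obtain e where e: "e > 0" "\<And>z. dist z (integral_l1loc b f) < e \<Longrightarrow> z \<in> V"
      using \<open>open V\<close> f unfolding open_dist by blast
    \<comment> \<open>For such \<open>n\<close> the \<open>n\<close>-th seminorm dominates the
      functional, so its \<open>e\<close>-ball around \<open>f\<close> is mapped into
      \<open>V\<close>.\<close>
    obtain n where "b \<le> real n"
      using real_arch_simple by blast
    have "integral_l1loc b g \<in> V" if "seminorm_l1loc n (g - f) < e" for g
      using norm_integral_l1loc_le[OF \<open>b \<le> real n\<close>, of "g - f"] that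
      by (intro e(2)) (simp add: dist_norm module_hom.diff[OF
            linear_integral_l1loc[unfolded linear_iff_module_hom]])
    with e(1) show ?thesis by blast
  qed
  then show "open (integral_l1loc b -` V \<inter> UNIV)"
    by (auto simp: open_l1loc_def)
qed

lemma l1loc_eq_0_if_integral_zero: "(\<And>b. 0 < b \<Longrightarrow> integral_l1loc b f = 0) \<Longrightarrow> f = 0"
proof (transfer, goal_cases)
  case (1 f)
  then show ?case
    by (auto simp: locally_integrable_def set_integrable_def intro!: eq_ae_zero_if_integral_zero)
qed

section \<open>Weak topology and boundedness\<close>

text \<open>The carrier of a generated topology is the union of its generators, and the zero
  functional contributes the whole space as a generator.\<close>

lemma topspace_weak_topology:
  assumes "vector_space smul"
  shows "topspace (weak_topology smul) = UNIV"
proof -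
  have "Vector_Spaces.linear smul (*) (\<lambda>_. 0 :: complex)"
    using assms by (simp add: Vector_Spaces.linear_iff vector_space_over_itself.vector_space_axioms)
  then have "(\<lambda>_. 0 :: complex) -` UNIV \<in> {\<phi> -` V | \<phi> V.
      Vector_Spaces.linear smul (*) \<phi> \<and> continuous_on UNIV \<phi> \<and> open (V :: complex set)}"
    by (intro CollectI exI[of _ "\<lambda>_. 0 :: complex"] exI[of _ UNIV]) auto
  then show ?thesis
    unfolding weak_topology_def topology_generated_by_topspace by auto
qed

lemma continuous_map_weak_topology:
  assumes "Vector_Spaces.linear smul (*) \<phi>" "continuous_on UNIV \<phi>"
  shows "continuous_map (weak_topology smul) euclidean (\<phi> :: _ \<Rightarrow> complex)"
proof -
  have "openin (weak_topology smul) (\<phi> -` V)" if "open V" for V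
    unfolding weak_topology_def using assms that by (intro topology_generated_by_Basis) auto
  moreover have "topspace (weak_topology smul) = UNIV"
    using assms(1) by (simp add: topspace_weak_topology Vector_Spaces.linear_iff)
  ultimately show ?thesis
    by (simp add: continuous_map_def vimage_def)
qed

text \<open>The weak closure of \<open>S\<close> is weakly compact, so its image under the weakly
  continuous \<open>\<phi>\<close> is a compact set of complex numbers, which contains the image of
  \<open>S\<close>.\<close>

lemma bounded_image_if_weakly_relatively_compact:
  assumes S: "weakly_relatively_compact smul S"
    and \<phi>: "Vector_Spaces.linear smul (*) \<phi>" "continuous_on UNIV \<phi>"
  shows "bounded ((\<phi> :: _ \<Rightarrow> complex) ` S)"
proof -
  have "compact (\<phi> ` (weak_topology smul closure_of S))"
    using image_compactin[OF S[unfolded weakly_relatively_compact_def]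
        continuous_map_weak_topology[OF \<phi>]] by simp
  moreover have "S \<subseteq> weak_topology smul closure_of S"
    using \<phi>(1) by (intro closure_of_subset) (simp add: topspace_weak_topology Vector_Spaces.linear_iff)
  ultimately show ?thesis
    by (meson bounded_subset compact_imp_bounded image_mono)
qed

lemma seminorm_l1loc_scale: "seminorm_l1loc n (scale_l1loc c f) = norm c * seminorm_l1loc n f"
  by transfer (simp add: norm_mult)

lemma weakly_compact_operator_vanishes_beyond:
  assumes "weakly_compact_operator scale_l1loc scale_l1loc T"
  obtains n where "\<And>f. seminorm_l1loc n f = 0 \<Longrightarrow> T f = 0"
proof -
  obtain N where N: "0 \<in> interior N" "weakly_relatively_compact scale_l1loc (T ` N)"
    and T: "Vector_Spaces.linear scale_l1loc scale_l1loc T"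
    using assms unfolding weakly_compact_operator_def by blast
  have "open (interior N)" by simp
  with N(1) obtain n e where ne: "e > 0" "\<And>g. seminorm_l1loc n g < e \<Longrightarrow> g \<in> interior N"
    unfolding open_l1loc_def by force
  have "T f = 0" if f: "seminorm_l1loc n f = 0" for f
  proof (rule l1loc_eq_0_if_integral_zero)
    fix b
    have mem: "scale_l1loc c f \<in> N" for c
      using ne(2)[of "scale_l1loc c f"] ne(1) interior_subset[of N] by (simp add: seminorm_l1loc_scale f subset_iff)
    obtain B where B: "\<And>g. g \<in> N \<Longrightarrow> norm (integral_l1loc b (T g)) \<le> B"
      using bounded_image_if_weakly_relatively_compact[OF N(2) linear_integral_l1loc
          continuous_integral_l1loc] unfolding bounded_iff by blast
    have bound: "norm c * norm (integral_l1loc b (T f)) \<le> B" for c :: complex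
      using B[OF mem[of c]] T linear_integral_l1loc[of b]
      by (simp add: Vector_Spaces.linear_iff norm_mult)
    show "integral_l1loc b (T f) = 0"
    proof (rule ccontr)
      assume "integral_l1loc b (T f) \<noteq> 0"
      then show False
        \<comment> \<open>This scalar makes the left side of \<open>bound\<close> equal to
          \<open>\<bar>B\<bar> + 1\<close>, which exceeds \<open>B\<close>.\<close>
        using bound[of "of_real ((\<bar>B\<bar> + 1) / norm (integral_l1loc b (T f)))"]
        by (simp add: norm_divide)
    qed
  qed
  then show ?thesis by (rule that)
qed

section \<open>Convolution with the indicator of a tail\<close>

lift_definition tail_l1loc :: "nat \<Rightarrow> l1loc" is "\<lambda>n. indicator {real n..}"
proof -
  fix n :: nat
  have "set_integrable lebesgue {0..b} (indicator {real n..} :: real \<Rightarrow> complex)" for b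
  proof -
    have "integrable lebesgue (\<lambda>t. indicator {real n..b} t :: complex)"
      using absolutely_integrable_on_const[of "{real n..b}" "1 :: complex"]
      by (simp add: set_integrable_def scaleR_conv_of_real of_real_indicator)
    moreover have "(\<lambda>t. indicator {real n..b} t :: complex)
        = (\<lambda>t. indicator {0..b} t *\<^sub>R indicator {real n..} t)"
      by (auto simp: indicator_def)
    ultimately show ?thesis by (simp add: set_integrable_def)
  qed
  then show "locally_integrable (indicator {real n..}) \<and> locally_integrable (indicator {real n..})
      \<and> eq_ae (indicator {real n..}) (indicator {real n..})"
    by (simp add: locally_integrable_def eq_ae_def)
qed

lemma seminorm_tail_l1loc: "seminorm_l1loc n (tail_l1loc n) = 0"
proof (transfer, goal_cases)
  case (1 n)
  \<comment> \<open>The tail meets \<open>{0..real n}\<close> in this single point.\<close>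
  have "AE t in lebesgue. t \<noteq> real n"
    by (simp add: AE_completion_iff AE_lborel_singleton)
  then have "AE t in lebesgue. indicator {0..real n} t *\<^sub>R norm (indicator {real n..} t :: complex) = 0"
    by eventually_elim (auto simp: indicator_def)
  then show ?case
    unfolding set_lebesgue_integral_def by (rule integral_eq_zero_AE)
qed

text \<open>The reflection of \<open>s\<close> to \<open>t - s\<close> takes
  \<open>{0..t - c}\<close> to \<open>{c..t}\<close>. Convolution with the tail is thus the
  antiderivative of \<open>h\<close> delayed by \<open>c\<close>.\<close>

lemma convolution_tail:
  assumes "0 \<le> c"
  shows "convolution (indicator {c..}) h t = (LINT s:{0..t - c}|lebesgue. h s)"
proof -
  have "(LINT s:{0..t - c}|lebesgue. h s)
      = (LINT s|lebesgue. indicator {0..t - c} (t + (-1) * s) *\<^sub>R h (t + (-1) * s))"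
    unfolding set_lebesgue_integral_def
    using lebesgue_integral_real_affine[of "-1" "\<lambda>s. indicator {0..t - c} s *\<^sub>R h s" t] by simp
  also have "\<dots> = convolution (indicator {c..}) h t"
    unfolding convolution_def set_lebesgue_integral_def
    using assms by (intro Bochner_Integration.integral_cong) (auto simp: indicator_def)
  finally show ?thesis ..
qed

lemma seminorm_tail_times_l1loc: "seminorm_l1loc n (tail_l1loc n * g) = 0"
proof (transfer, goal_cases)
  case (1 n g)
  have ae: "AE t in lebesgue. t \<noteq> real n"
    by (simp add: AE_completion_iff AE_lborel_singleton)
  have "AE t in lebesgue. indicator {0..real n} t *\<^sub>R norm (convolution (indicator {real n..}) g t) = 0"
    \<comment> \<open>For \<open>t < real n\<close> the range of integration
      \<open>{0..t - real n}\<close> is empty.\<close>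
    using ae by eventually_elim (auto simp: convolution_tail set_lebesgue_integral_def split: split_indicator)
  then show ?case
    unfolding set_lebesgue_integral_def by (rule integral_eq_zero_AE)
qed

text \<open>The assumption says that the antiderivative of \<open>h\<close> vanishes almost
  everywhere; being continuous it vanishes everywhere, and then so does \<open>h\<close> almost
  everywhere.\<close>

lemma tail_times_l1loc_eq_0_imp: "tail_l1loc n * h = 0 \<Longrightarrow> h = 0"
proof (transfer, goal_cases)
  case (1 n h)
  then have h: "locally_integrable h" and "eq_ae (convolution (indicator {real n..}) h) (\<lambda>_. 0)"
    by auto
  then have "AE t in lebesgue. 0 \<le> t \<longrightarrow> (LINT s:{0..t - real n}|lebesgue. h s) = 0"
    by (simp add: eq_ae_def convolution_tail)
  \<comment> \<open>Two reflections, about 0 and then with \<open>- real n\<close>, compose to the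
    translation from \<open>b\<close> to \<open>b + real n\<close>, which undoes the delay.\<close>
  from AE_lebesgue_reflect[OF this, of 0] have
    "AE t in lebesgue. 0 \<le> -t \<longrightarrow> (LINT s:{0..-t - real n}|lebesgue. h s) = 0" by simp
  from AE_lebesgue_reflect[OF this, of "- real n"] have
    ae: "AE b in lebesgue. 0 \<le> b \<longrightarrow> (LINT s:{0..b}|lebesgue. h s) = 0"
    by (auto elim!: eventually_mono)
  have "(LINT s:{0..b}|lebesgue. h s) = 0" if "0 < b" for b
  proof -
    have HK: "h integrable_on {0..a}" "(LINT s:{0..a}|lebesgue. h s) = integral {0..a} h" for a
      using h set_lebesgue_integral_eq_integral unfolding locally_integrable_def by blast+
    have "closed {x \<in> {0..b + 1}. integral {0..x} h = 0}"
      using indefinite_integral_continuous_1[OF HK(1)]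
      by (intro continuous_closed_preimage_constant) auto
    \<comment> \<open>A closed set containing almost every point of an open set contains all of it;
      the endpoint \<open>b + 1\<close> places \<open>b\<close> in the open interval.\<close>
    moreover have "AE x in lebesgue. x \<in> {0<..<b + 1} \<longrightarrow> x \<in> {x \<in> {0..b + 1}. integral {0..x} h = 0}"
      using ae unfolding HK(2) by eventually_elim auto
    ultimately have "b \<in> {x \<in> {0..b + 1}. integral {0..x} h = 0}"
      by (rule mem_closed_if_AE_lebesgue_open[OF open_greaterThanLessThan]) (use that in simp)
    then show ?thesis by (simp add: HK(2))
  qed
  with h show ?case
    by (auto simp: locally_integrable_def set_integrable_def intro!: eq_ae_zero_if_integral_zero)
qed

lemma times_l1loc_zero: "0 * g = (0 :: l1loc)" "f * 0 = (0 :: l1loc)"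
  by (transfer; simp add: convolution_def[abs_def] eq_ae_def locally_integrable_def set_integrable_def)+

theorem corollary3p5:
  shows "\<not> (\<exists>D. l1loc_derivation D \<and> D \<noteq> (\<lambda>_. 0)
           \<and> weakly_compact_operator scale_l1loc scale_l1loc D)"
proof
  assume "\<exists>D. l1loc_derivation D \<and> D \<noteq> (\<lambda>_. 0) \<and> weakly_compact_operator scale_l1loc scale_l1loc D"
  then obtain D where D: "l1loc_derivation D" "D \<noteq> (\<lambda>_. 0)"
    "weakly_compact_operator scale_l1loc scale_l1loc D" by blast
  obtain n where n: "\<And>f. seminorm_l1loc n f = 0 \<Longrightarrow> D f = 0"
    using weakly_compact_operator_vanishes_beyond[OF D(3)] by blast
  have "D g = 0" for g
  proof (rule tail_times_l1loc_eq_0_imp)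
    have "D (tail_l1loc n * g) = D (tail_l1loc n) * g + tail_l1loc n * D g"
      using D(1) by (simp add: l1loc_derivation_def)
    then show "tail_l1loc n * D g = 0"
      by (simp add: n seminorm_tail_l1loc seminorm_tail_times_l1loc times_l1loc_zero)
  qed
  with D(2) show False by auto
qed

end
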